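(* Every finite Boolean combination of fuzzy c.e. sets (i.e., every fuzzy set obtained from finitely many fuzzy c.e. sets by finitely many applications of union, intersection and complement) is fuzzy $n$-c.e. for some $n \geq 1$.
   Context: A fuzzy subset of $\omega$ is a function $A\colon \omega \to [0;1]_{\mathbb{R}}$. Operations: $(A\cup B)(x) = \max\{A(x),B(x)\}$, $(A\cap B)(x) = \min\{A(x),B(x)\}$, $\overline{A}(x) = 1 - A(x)$. $[0;1]_{\mathbb{Q}}$ denotes the rationals in $[0,1]$, coded effectively by natural numbers. A fuzzy set $A$ is (fuzzy) c.e. if there is a computable $f\colon \omega\times\omega\to[0;1]_{\mathbb{Q}}$ with $\lim_s f(x,s) = A(x)$ and $f(x,s+1)\geq f(x,s)$ for all $x,s$. For a total $f\colon \omega\times\omega \to [0;1]_{\mathbb{Q}}$, its $\Sigma$-mind change function $m^f_\Sigma\colon \omega\times\omega \to \{-1,1\}$ is defined by: $m^f_\Sigma(x,0) = 1$; if $m^f_\Sigma(x,s)=1$, then $m^f_\Sigma(x,s+1)=1$ when $f(x,s)\leq f(x,s+1)$ and $m^f_\Sigma(x,s+1)=-1$ when $f(x,s) > f(x,s+1)$; if $m^f_\Sigma(x,s)=-1$, then $m^f_\Sigma(x,s+1)=-1$ when $f(x,s)\geq f(x,s+1)$ and $m^f_\Sigma(x,s+1)=1$ when $f(x,s)<f(x,s+1)$. A fuzzy set $A$ is fuzzy $n$-c.e. ($n \geq 1$) if there is a computable $f\colon \omega\times\omega \to [0;1]_{\mathbb{Q}}$ such that for all $x$: $\lim_s f(x,s)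 = A(x)$, $f(x,0) = 0$, and $|\{s \in \omega : m^f_\Sigma(x,s+1) \neq m^f_\Sigma(x,s)\}| \leq n-1$. *)

theory Defs
  imports Complex_Main "HOL-Library.Nat_Bijection"
begin

text \<open>Partial recursive functions: programs and their big-step evaluation on argument lists.
  In primitive recursion and minimization the distinguished argument comes first.\<close>

datatype recf =
    Zero
  | Succ
  | Proj nat
  | Comp recf "recf list"
  | PrimRec recf recf
  | Mu recf

inductive eval :: "recf \<Rightarrow> nat list \<Rightarrow> nat \<Rightarrow> bool" where
  eval_Zero: "eval Zero xs 0"
| eval_Succ: "eval Succ [x] (Suc x)"
| eval_Proj: "i < length xs \<Longrightarrow> eval (Proj i) xs (xs ! i)"
| eval_Comp: "list_all2 (\<lambda>g y. eval g xs y) gs ys \<Longrightarrow> eval f ys z \<Longrightarrow> eval (Comp f gs) xs z"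
| eval_PrimRec_0: "eval f xs y \<Longrightarrow> eval (PrimRec f g) (0 # xs) y"
| eval_PrimRec_Suc: "eval (PrimRec f g) (n # xs) r \<Longrightarrow> eval g (n # r # xs) y
    \<Longrightarrow> eval (PrimRec f g) (Suc n # xs) y"
| eval_Mu: "eval f (y # xs) 0 \<Longrightarrow> (\<forall>z<y. \<exists>v>0. eval f (z # xs) v) \<Longrightarrow> eval (Mu f) xs y"

lemma eval_deterministic: "eval p xs y \<Longrightarrow> eval p xs z \<Longrightarrow> y = z"
proof (induction arbitrary: z rule: eval.induct)
  case (eval_Zero xs)
  then show ?case by (auto elim: eval.cases)
next
  case (eval_Succ x)
  then show ?case by (auto elim: eval.cases)
next
  case (eval_Proj i xs)
  from eval_Proj.prems show ?case by (auto elim: eval.cases)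
next
  case (eval_Comp xs gs ys f w)
  from eval_Comp.prems obtain ys' where ys': "list_all2 (\<lambda>g y. eval g xs y) gs ys'" "eval f ys' z"
    by (auto elim: eval.cases)
  have "ys = ys'"
    using eval_Comp.IH(1) ys'(1) by (auto simp: list_all2_conv_all_nth intro!: nth_equalityI)
  then show ?case using eval_Comp.IH(2) ys'(2) by blast
next
  case (eval_PrimRec_0 f xs y g)
  from eval_PrimRec_0.prems show ?case
    by (rule eval.cases) (use eval_PrimRec_0.IH in auto)
next
  case (eval_PrimRec_Suc f g n xs r y)
  from eval_PrimRec_Suc.prems show ?case
    by (rule eval.cases) (use eval_PrimRec_Suc.IH in auto)
next
  case (eval_Mu f y xs)
  from eval_Mu.prems have z: "eval f (z # xs) 0" "\<forall>u<z. \<exists>v>0. eval f (u # xs) v"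
    by (auto elim: eval.cases)
  have "\<not> z < y" using z(1) eval_Mu.IH(2) by fastforce
  moreover have "\<not> y < z" using z(2) eval_Mu.IH(1) by fastforce
  ultimately show ?case by simp
qed

definition computable2 :: "(nat \<Rightarrow> nat \<Rightarrow> nat) \<Rightarrow> bool" where
  "computable2 h \<longleftrightarrow> (\<exists>p. \<forall>x s. eval p [x, s] (h x s))"

text \<open>The coding of the rationals in \<open>[0, 1]\<close>: numerator and denominator in lowest terms, combined
  by the Cantor pairing function. It is only meaningful for nonnegative rationals.\<close>

definition rat_code :: "rat \<Rightarrow> nat" where
  "rat_code q = (case quotient_of q of (a, b) \<Rightarrow> prod_encode (nat a, nat b))"

lemma inj_on_rat_code: "inj_on rat_code {0..1}"
proof (rule inj_onI)
  fix p q :: rat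
  assume pq: "p \<in> {0..1}" "q \<in> {0..1}" "rat_code p = rat_code q"
  obtain a b where ab: "quotient_of p = (a, b)" by fastforce
  obtain c d where cd: "quotient_of q = (c, d)" by fastforce
  have pos: "b > 0" "d > 0" using ab cd quotient_of_denom_pos by blast+
  have eq: "p = of_int a / of_int b" "q = of_int c / of_int d"
    using ab cd quotient_of_div by blast+
  have "a \<ge> 0" "c \<ge> 0" using pq(1,2) pos unfolding eq by (auto simp: zero_le_divide_iff)
  moreover have "nat a = nat c" "nat b = nat d"
    using pq(3) ab cd by (auto simp: rat_code_def)
  ultimately have "a = c" "b = d" using pos by (simp_all add: eq_nat_nat_iff)
  then show "p = q" using eq by simp
qed

definition computable_rat01 :: "(nat \<Rightarrow> nat \<Rightarrow> rat) \<Rightarrow> bool" where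
  "computable_rat01 f \<longleftrightarrow>
     (\<forall>x s. f x s \<in> {0..1}) \<and> computable2 (\<lambda>x s. rat_code (f x s))"

type_synonym fuzzy = "nat \<Rightarrow> real"

definition fuzzy_set :: "fuzzy \<Rightarrow> bool" where
  "fuzzy_set A \<longleftrightarrow> (\<forall>x. A x \<in> {0..1})"

definition fuzzy_union :: "fuzzy \<Rightarrow> fuzzy \<Rightarrow> fuzzy" where
  "fuzzy_union A B = (\<lambda>x. max (A x) (B x))"

definition fuzzy_inter :: "fuzzy \<Rightarrow> fuzzy \<Rightarrow> fuzzy" where
  "fuzzy_inter A B = (\<lambda>x. min (A x) (B x))"

definition fuzzy_compl :: "fuzzy \<Rightarrow> fuzzy" where
  "fuzzy_compl A = (\<lambda>x. 1 - A x)"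

definition fuzzy_ce :: "fuzzy \<Rightarrow> bool" where
  "fuzzy_ce A \<longleftrightarrow> fuzzy_set A \<and>
     (\<exists>f. computable_rat01 f \<and>
        (\<forall>x. (\<lambda>s. real_of_rat (f x s)) \<longlonglongrightarrow> A x) \<and>
        (\<forall>x s. f x (Suc s) \<ge> f x s))"

fun mind_change :: "(nat \<Rightarrow> nat \<Rightarrow> rat) \<Rightarrow> nat \<Rightarrow> nat \<Rightarrow> int" where
  "mind_change f x 0 = 1"
| "mind_change f x (Suc s) =
     (if mind_change f x s = 1
      then (if f x s \<le> f x (Suc s) then 1 else -1)
      else (if f x s \<ge> f x (Suc s) then -1 else 1))"

definition fuzzy_nce :: "nat \<Rightarrow> fuzzy \<Rightarrow> bool" where
  "fuzzy_nce n A \<longleftrightarrow> n \<ge> 1 \<and> fuzzy_set A \<and>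
     (\<exists>f. computable_rat01 f \<and>
        (\<forall>x. (\<lambda>s. real_of_rat (f x s)) \<longlonglongrightarrow> A x \<and>
             f x 0 = 0 \<and>
             finite {s. mind_change f x (Suc s) \<noteq> mind_change f x s} \<and>
             card {s. mind_change f x (Suc s) \<noteq> mind_change f x s} \<le> n - 1))"

inductive_set boolean_combinations :: "fuzzy set \<Rightarrow> fuzzy set" for C :: "fuzzy set" where
  base: "A \<in> C \<Longrightarrow> A \<in> boolean_combinations C"
| union: "A \<in> boolean_combinations C \<Longrightarrow> B \<in> boolean_combinations C
    \<Longrightarrow> fuzzy_union A B \<in> boolean_combinations C"
| inter: "A \<in> boolean_combinations C \<Longrightarrow> B \<in> boolean_combinations C
    \<Longrightarrow> fuzzy_inter A B \<in> boolean_combinations C"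
| compl: "A \<in> boolean_combinations C \<Longrightarrow> fuzzy_compl A \<in> boolean_combinations C"

end

theory Submission
  imports Defs
begin

text \<open>Approximate each Boolean combination by the same combination of the approximations of the
  c.e. sets. The pointwise maximum of an increasing and a decreasing sequence first decreases and
  then increases, so the class of sequences with a bounded number of changes of direction is closed
  under maximum and complement. A final shift by one stage makes the approximation start at 0.\<close>

section \<open>Computable functions\<close>

text \<open>Functions of \<open>k\<close> variables live on lists so that one set of closure lemmas
  serves every arity, with \<open>xs ! i\<close> as the \<open>i\<close>-th variable. Values of
  \<open>h\<close> on lists of other lengths are unconstrained.\<close>

definition computable_list :: "nat \<Rightarrow> (nat list \<Rightarrow> nat) \<Rightarrow> bool" where
  "computable_list k h \<longleftrightarrow> (\<exists>p. \<forall>xs. length xs = k \<longrightarrow> eval p xs (h xs))"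

definition computable1 :: "(nat \<Rightarrow> nat) \<Rightarrow> bool" where
  "computable1 h \<longleftrightarrow> (\<exists>p. \<forall>x. eval p [x] (h x))"

lemma computable1_iff: "computable1 h \<longleftrightarrow> computable_list 1 (\<lambda>xs. h (xs ! 0))"
proof
  assume "computable1 h"
  then obtain p where "\<And>x. eval p [x] (h x)" by (auto simp: computable1_def)
  then have "eval p xs (h (xs ! 0))" if "length xs = 1" for xs
    using that by (cases xs) auto
  then show "computable_list 1 (\<lambda>xs. h (xs ! 0))" by (auto simp: computable_list_def)
next
  assume "computable_list 1 (\<lambda>xs. h (xs ! 0))"
  then obtain p where p: "\<And>xs. length xs = 1 \<Longrightarrow> eval p xs (h (xs ! 0))"
    by (auto simp: computable_list_def)
  have "eval p [x] (h x)" for x using p[of "[x]"] by simp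
  then show "computable1 h" by (auto simp: computable1_def)
qed

lemma computable2_iff: "computable2 h \<longleftrightarrow> computable_list 2 (\<lambda>xs. h (xs ! 0) (xs ! 1))"
proof
  assume "computable2 h"
  then obtain p where p: "\<And>x y. eval p [x, y] (h x y)" by (auto simp: computable2_def)
  have "eval p xs (h (xs ! 0) (xs ! 1))" if "length xs = 2" for xs
  proof -
    have "xs = [xs ! 0, xs ! 1]" using that by (auto intro!: nth_equalityI simp: less_2_cases_iff)
    then show ?thesis using p by metis
  qed
  then show "computable_list 2 (\<lambda>xs. h (xs ! 0) (xs ! 1))" by (auto simp: computable_list_def)
next
  assume "computable_list 2 (\<lambda>xs. h (xs ! 0) (xs ! 1))"
  then obtain p where p: "\<And>xs. length xs = 2 \<Longrightarrow> eval p xs (h (xs ! 0) (xs ! 1))"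
    by (auto simp: computable_list_def)
  have "eval p [x, y] (h x y)" for x y using p[of "[x, y]"] by simp
  then show "computable2 h" by (auto simp: computable2_def)
qed

lemma computable_list_nth: "i < k \<Longrightarrow> computable_list k (\<lambda>xs. xs ! i)"
  unfolding computable_list_def by (rule exI[of _ "Proj i"]) (auto intro: eval_Proj)

lemma computable_list_comp1:
  assumes "computable1 h" "computable_list k a"
  shows "computable_list k (\<lambda>xs. h (a xs))"
proof -
  obtain p q where "\<And>x. eval p [x] (h x)" "\<And>xs. length xs = k \<Longrightarrow> eval q xs (a xs)"
    using assms by (auto simp: computable_list_def computable1_def)
  then have "eval (Comp p [q]) xs (h (a xs))" if "length xs = k" for xs
    using that by (intro eval_Comp[of _ _ "[a xs]"]) auto
  then show ?thesis by (auto simp: computable_list_def)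
qed

lemma computable_list_comp2:
  assumes "computable2 h" "computable_list k a" "computable_list k b"
  shows "computable_list k (\<lambda>xs. h (a xs) (b xs))"
proof -
  obtain p q r where "\<And>x y. eval p [x, y] (h x y)" "\<And>xs. length xs = k \<Longrightarrow> eval q xs (a xs)"
    "\<And>xs. length xs = k \<Longrightarrow> eval r xs (b xs)"
    using assms by (auto simp: computable_list_def computable2_def)
  then have "eval (Comp p [q, r]) xs (h (a xs) (b xs))" if "length xs = k" for xs
    using that by (intro eval_Comp[of _ _ "[a xs, b xs]"]) auto
  then show ?thesis by (auto simp: computable_list_def)
qed

text \<open>The program is \<open>Mu p\<close>. Since \<open>p\<close> computes a total
  \<open>g\<close>, every candidate below the least zero has a defined positive value, as
  \<open>eval_Mu\<close> demands.\<close>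

lemma computable_list_Least:
  assumes "computable_list (Suc k) g" and "\<And>xs. length xs = k \<Longrightarrow> \<exists>n. g (n # xs) = 0"
  shows "computable_list k (\<lambda>xs. LEAST n. g (n # xs) = 0)"
proof -
  obtain p where p: "\<And>xs. length xs = Suc k \<Longrightarrow> eval p xs (g xs)"
    using assms by (auto simp: computable_list_def)
  have "eval (Mu p) xs (LEAST n. g (n # xs) = 0)" if l: "length xs = k" for xs
  proof (rule eval_Mu)
    have "g ((LEAST n. g (n # xs) = 0) # xs) = 0"
      using LeastI_ex[OF assms(2)[OF l]] .
    then show "eval p ((LEAST n. g (n # xs) = 0) # xs) 0"
      using p[of "(LEAST n. g (n # xs) = 0) # xs"] l by simp
    show "\<forall>z<LEAST n. g (n # xs) = 0. \<exists>v>0. eval p (z # xs) v"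
    proof (intro allI impI)
      fix z assume "z < (LEAST n. g (n # xs) = 0)"
      then have "g (z # xs) \<noteq> 0" by (rule not_less_Least)
      then show "\<exists>v>0. eval p (z # xs) v" using p[of "z # xs"] l by auto
    qed
  qed
  then show ?thesis by (auto simp: computable_list_def)
qed

section \<open>Arithmetic by primitive recursion\<close>

lemma computable1_Suc: "computable1 Suc"
  unfolding computable1_def by (rule exI[of _ Succ]) (auto intro: eval_Succ)

lemma computable_list_Suc: "computable_list k a \<Longrightarrow> computable_list k (\<lambda>xs. Suc (a xs))"
  by (rule computable_list_comp1[OF computable1_Suc])

lemma computable_list_const: "computable_list k (\<lambda>xs. c)"
proof (induction c)
  case 0
  show ?case unfolding computable_list_def by (rule exI[of _ Zero]) (auto intro: eval_Zero)
qed (rule computable_list_Suc)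

lemmas computable_list_basic = computable_list_nth computable_list_Suc computable_list_const

lemma computable1_prim_rec:
  assumes "computable2 g" and "\<And>n. h (Suc n) = g n (h n)"
  shows "computable1 h"
proof -
  \<comment> \<open>Without parameters the base program runs on the empty argument list, so
    \<open>h 0\<close> enters as a nullary constant.\<close>
  obtain p q where p: "\<And>xs. length xs = 0 \<Longrightarrow> eval p xs (h 0)" and q: "\<And>n r. eval q [n, r] (g n r)"
    using assms(1) computable_list_const[of 0 "h 0"] by (auto simp: computable_list_def computable2_def)
  have "eval (PrimRec p q) [n] (h n)" for n
  proof (induction n)
    case 0
    show ?case using p by (auto intro: eval_PrimRec_0)
  next
    case (Suc n)
    show ?case using q by (auto simp: assms(2) intro!: eval_PrimRec_Suc[OF Suc])
  qed
  then show ?thesis by (auto simp: computable1_def)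
qed

lemma computable2_prim_rec:
  assumes "computable1 f" "computable_list 3 g"
    and "\<And>y. h 0 y = f y" "\<And>n y. h (Suc n) y = g [n, h n y, y]"
  shows "computable2 h"
proof -
  obtain p q where p: "\<And>x. eval p [x] (f x)"
    and q: "\<And>xs. length xs = 3 \<Longrightarrow> eval q xs (g xs)"
    using assms by (auto simp: computable_list_def computable1_def)
  have "eval (PrimRec p q) [n, y] (h n y)" for n y
  proof (induction n)
    case 0
    show ?case using p assms(3) by (auto intro: eval_PrimRec_0)
  next
    case (Suc n)
    show ?case using q by (auto simp: assms(4) intro!: eval_PrimRec_Suc[OF Suc])
  qed
  then show ?thesis by (auto simp: computable2_def)
qed

lemma computable2_add: "computable2 (+)"
  by (rule computable2_prim_rec[where f = "\<lambda>y. y" and g = "\<lambda>xs. Suc (xs ! 1)"])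
    (auto simp: computable1_iff intro!: computable_list_basic)

lemmas computable_list_add = computable_list_comp2[OF computable2_add]

lemma computable2_mult: "computable2 (*)"
  by (rule computable2_prim_rec[where f = "\<lambda>y. 0" and g = "\<lambda>xs. xs ! 1 + xs ! 2"])
    (auto simp: computable1_iff intro!: computable_list_basic computable_list_add)

lemmas computable_list_mult = computable_list_comp2[OF computable2_mult]

lemma computable1_pred: "computable1 (\<lambda>n. n - 1)"
  by (rule computable1_prim_rec[where g = "\<lambda>n r. n"])
    (auto simp: computable2_iff intro!: computable_list_basic)

lemma computable_list_diff:
  assumes "computable_list k a" "computable_list k b"
  shows "computable_list k (\<lambda>xs. a xs - b xs)"
proof -
  \<comment> \<open>Subtraction iterates the predecessor. The recursion argument comes first, so the
    subtrahend does too, and the order is swapped back on composition.\<close>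
  have "computable2 (\<lambda>n y. y - n)"
    by (rule computable2_prim_rec[where f = "\<lambda>y. y" and g = "\<lambda>xs. xs ! 1 - 1"])
      (auto simp: computable1_iff
        intro!: computable_list_basic computable_list_comp1[OF computable1_pred, simplified])
  from computable_list_comp2[OF this assms(2,1)] show ?thesis .
qed

lemma computable1_triangle: "computable1 triangle"
  by (rule computable1_prim_rec[where g = "\<lambda>n r. r + Suc n"])
    (auto simp: computable2_iff intro!: computable_list_basic computable_list_add)

lemmas computable_list_triangle = computable_list_comp1[OF computable1_triangle]

lemmas computable_list_arith =
  computable_list_basic computable_list_add computable_list_mult computable_list_diff
  computable_list_triangle

lemma computable_list_if_le:
  assumes "computable_list k a" "computable_list k b" "computable_list k u" "computable_list k v"
  shows "computable_list k (\<lambda>xs. if a xs \<le> b xs then u xs else v xs)"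
proof -
  \<comment> \<open>With truncated subtraction, \<open>1 - (a xs - b xs)\<close> is the indicator of
    \<open>a xs \<le> b xs\<close>, and one minus it is the indicator of the opposite case.\<close>
  have "(if a xs \<le> b xs then u xs else v xs) =
      (1 - (a xs - b xs)) * u xs + (1 - (1 - (a xs - b xs))) * v xs" for xs
    by auto
  then show ?thesis by (simp only:) (intro computable_list_arith assms)
qed

lemma computable_list_prod_encode:
  assumes "computable_list k a" "computable_list k b"
  shows "computable_list k (\<lambda>xs. prod_encode (a xs, b xs))"
  unfolding prod_encode_def by (simp, intro computable_list_arith assms)

section \<open>Decoding of Cantor pairs\<close>

lemma triangle_mono: "m \<le> n \<Longrightarrow> triangle m \<le> triangle n"
  by (induction n) (auto simp: le_Suc_eq)

lemma le_triangle: "n \<le> triangle n"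
  by (induction n) auto

text \<open>The code is \<open>triangle (a + b) + a\<close>, which lies in the interval from
  \<open>triangle (a + b)\<close> up to but excluding \<open>triangle (Suc (a + b))\<close>. The
  truncated difference vanishes exactly when the code is below \<open>triangle (Suc t)\<close>, so
  the search finds the diagonal.\<close>

lemma Least_triangle_prod_encode: "(LEAST t. Suc (prod_encode (a, b)) - triangle (Suc t) = 0) = a + b"
proof (rule Least_equality)
  show "Suc (prod_encode (a, b)) - triangle (Suc (a + b)) = 0" by (simp add: prod_encode_def)
next
  fix t assume "Suc (prod_encode (a, b)) - triangle (Suc t) = 0"
  then have t: "triangle (a + b) < triangle (Suc t)" by (simp add: prod_encode_def)
  show "a + b \<le> t"
    using triangle_mono[of "Suc t" "a + b"] t by linarith
qed

lemma computable1_diagonal: "computable1 (\<lambda>n. LEAST t. Suc n - triangle (Suc t) = 0)"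
proof -
  \<comment> \<open>Minimization puts the search variable at position 0, which moves the input to
    position 1.\<close>
  have "computable_list 1 (\<lambda>xs. LEAST t. (\<lambda>ys. Suc (ys ! 1) - triangle (Suc (ys ! 0))) (t # xs) = 0)"
  proof (rule computable_list_Least)
    show "computable_list (Suc 1) (\<lambda>ys. Suc (ys ! 1) - triangle (Suc (ys ! 0)))"
      by (intro computable_list_arith) auto
    \<comment> \<open>The search succeeds at the input itself, because
      \<open>m < triangle (Suc m)\<close>.\<close>
    show "\<exists>n. Suc ((n # xs) ! 1) - triangle (Suc ((n # xs) ! 0)) = 0" for xs
      using le_triangle[of "Suc (xs ! 0)"] by (intro exI[of _ "xs ! 0"]) (simp del: triangle_Suc)
  qed
  then show ?thesis by (simp add: computable1_iff del: triangle_Suc)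
qed

text \<open>Subtracting the triangular number of the diagonal \<open>a + b\<close> from the code
  leaves \<open>a\<close>; the second component is then the diagonal minus \<open>a\<close>.\<close>

lemma computable1_fst_prod_decode: "computable1 (\<lambda>n. fst (prod_decode n))"
proof -
  have "fst (prod_decode n) = n - triangle (LEAST t. Suc n - triangle (Suc t) = 0)" for n
  proof -
    obtain a b where n: "n = prod_encode (a, b)" by (metis prod_decode_inverse surj_pair)
    have "n - triangle (a + b) = a" by (simp add: n prod_encode_def)
    then show ?thesis unfolding n Least_triangle_prod_encode by simp
  qed
  then show ?thesis unfolding computable1_iff
    by (simp only:) (intro computable_list_arith computable_list_comp1[OF computable1_diagonal], auto)
qed

lemma computable1_snd_prod_decode: "computable1 (\<lambda>n. snd (prod_decode n))"
proof -
  have "snd (prod_decode n) = (LEAST t. Suc n - triangle (Suc t) = 0) - fst (prod_decode n)" for n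
  proof -
    obtain a b where n: "n = prod_encode (a, b)" by (metis prod_decode_inverse surj_pair)
    show ?thesis unfolding n Least_triangle_prod_encode by simp
  qed
  then show ?thesis unfolding computable1_iff
    by (simp only:) (intro computable_list_arith computable_list_comp1[OF computable1_diagonal]
        computable_list_comp1[OF computable1_fst_prod_decode], auto)
qed

lemmas computable_list_prod_decode =
  computable_list_comp1[OF computable1_fst_prod_decode]
  computable_list_comp1[OF computable1_snd_prod_decode]

section \<open>Computable rational-valued functions\<close>

text \<open>For nonnegative \<open>q\<close> the conversion \<open>nat\<close> in
  \<open>rat_code\<close> loses nothing, so the reduced fraction can be handled entirely in natural
  numbers.\<close>

lemma quotient_of_nonneg:
  assumes "0 \<le> q"
  obtains a b where "quotient_of q = (int a, int b)" "b > 0" "coprime a b"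
    "q = of_nat a / of_nat b" "rat_code q = prod_encode (a, b)"
proof -
  obtain i j where ij: "quotient_of q = (i, j)" by fastforce
  have j: "j > 0" using ij quotient_of_denom_pos by blast
  have eq: "q = of_int i / of_int j" using ij quotient_of_div by blast
  have i: "i \<ge> 0" using assms j unfolding eq by (auto simp: zero_le_divide_iff)
  have cop: "coprime i j" using ij quotient_of_coprime by blast
  obtain a b where "i = int a" "j = int b" using i j by (metis less_imp_le zero_le_imp_eq_int)
  then show thesis using that[of a b] ij j eq cop by (simp add: rat_code_def)
qed

text \<open>Denominators are positive, so cross-multiplication decides the order. The result is one
  of the two given codes and hence already in lowest terms.\<close>

lemma rat_code_max:
  assumes "0 \<le> p" "0 \<le> q"
  shows "rat_code (max p q) =
    (if fst (prod_decode (rat_code p)) * snd (prod_decode (rat_code q))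
        \<le> fst (prod_decode (rat_code q)) * snd (prod_decode (rat_code p))
     then rat_code q else rat_code p)"
proof -
  obtain a b where p: "b > 0" "p = of_nat a / of_nat b" "rat_code p = prod_encode (a, b)"
    using quotient_of_nonneg[OF assms(1)] by metis
  obtain c d where q: "d > 0" "q = of_nat c / of_nat d" "rat_code q = prod_encode (c, d)"
    using quotient_of_nonneg[OF assms(2)] by metis
  have "p \<le> q \<longleftrightarrow> (of_nat (a * d) :: rat) \<le> of_nat (c * b)"
    unfolding p(2) q(2) using p(1) q(1) by (simp add: divide_simps)
  then have "p \<le> q \<longleftrightarrow> a * d \<le> c * b" by (simp only: of_nat_le_iff)
  then show ?thesis using p(3) q(3) by (simp add: max_def)
qed

text \<open>The fraction \<open>(b - a) / b\<close> inherits lowest terms from \<open>a / b\<close>,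
  since \<open>b - a\<close> and \<open>b\<close> have the same gcd as \<open>a\<close> and
  \<open>b\<close>. The bound \<open>q \<le> 1\<close> gives \<open>a \<le> b\<close>, which makes
  the natural subtraction exact.\<close>

lemma rat_code_compl:
  assumes "0 \<le> q" "q \<le> 1"
  shows "rat_code (1 - q) = prod_encode
    (snd (prod_decode (rat_code q)) - fst (prod_decode (rat_code q)), snd (prod_decode (rat_code q)))"
proof -
  obtain a b where q: "b > 0" "coprime a b" "q = of_nat a / of_nat b" "rat_code q = prod_encode (a, b)"
    using quotient_of_nonneg[OF assms(1)] by metis
  have "(of_nat a :: rat) \<le> of_nat b" using assms(2) q(1) unfolding q(3) by (simp add: divide_simps)
  then have ab: "a \<le> b" by simp
  have "1 - q = Fract (int b - int a) (int b)"
    using q(1) unfolding q(3) by (simp add: Fract_of_int_quotient divide_simps)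
  moreover have "coprime (int b - int a) (int b)"
  proof -
    have "coprime (int a) (int b)" using q(2) by simp
    then show ?thesis
      by (metis coprime_commute coprime_iff_gcd_eq_1 gcd_diff2 gcd.commute)
  qed
  ultimately have "quotient_of (1 - q) = (int b - int a, int b)"
    using q(1) by (simp add: quotient_of_Fract)
  then show ?thesis using q(4) ab by (simp add: rat_code_def nat_diff_distrib)
qed

section \<open>Closure of computable approximations under maximum, complement and shift\<close>

lemma computable_rat01_max:
  assumes "computable_rat01 f" "computable_rat01 g"
  shows "computable_rat01 (\<lambda>x s. max (f x s) (g x s))"
proof -
  have f: "\<And>x s. 0 \<le> f x s" "\<And>x s. f x s \<le> 1" and g: "\<And>x s. 0 \<le> g x s" "\<And>x s. g x s \<le> 1"
    using assms by (auto simp: computable_rat01_def)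
  have cf: "computable_list 2 (\<lambda>xs. rat_code (f (xs ! 0) (xs ! 1)))"
    and cg: "computable_list 2 (\<lambda>xs. rat_code (g (xs ! 0) (xs ! 1)))"
    using assms unfolding computable_rat01_def computable2_iff by blast+
  have "computable2 (\<lambda>x s. rat_code (max (f x s) (g x s)))"
    unfolding computable2_iff rat_code_max[OF f(1) g(1)]
    by (intro computable_list_if_le computable_list_mult computable_list_prod_decode cf cg)
  then show ?thesis using f g by (auto simp: computable_rat01_def le_max_iff_disj)
qed

lemma computable_rat01_compl:
  assumes "computable_rat01 f"
  shows "computable_rat01 (\<lambda>x s. 1 - f x s)"
proof -
  have f: "\<And>x s. 0 \<le> f x s" "\<And>x s. f x s \<le> 1"
    using assms by (auto simp: computable_rat01_def)
  have cf: "computable_list 2 (\<lambda>xs. rat_code (f (xs ! 0) (xs ! 1)))"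
    using assms unfolding computable_rat01_def computable2_iff by blast+
  have "computable2 (\<lambda>x s. rat_code (1 - f x s))"
    unfolding computable2_iff rat_code_compl[OF f]
    by (intro computable_list_prod_encode computable_list_diff computable_list_prod_decode cf)
  then show ?thesis using f by (auto simp: computable_rat01_def)
qed

lemma computable_rat01_shift:
  assumes "computable_rat01 f"
  shows "computable_rat01 (\<lambda>x s. if s = 0 then 0 else f x (s - 1))"
proof -
  have cf: "computable2 (\<lambda>x s. rat_code (f x s))"
    using assms by (auto simp: computable_rat01_def)
  \<comment> \<open>The test \<open>s = 0\<close> becomes \<open>s \<le> 0\<close> to match the
    available case distinction on natural numbers.\<close>
  have eq: "rat_code (if s = 0 then 0 else f x (s - 1)) =
      (if s \<le> 0 then rat_code 0 else rat_code (f x (s - 1)))" for x s by simp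
  have "computable2 (\<lambda>x s. rat_code (if s = 0 then 0 else f x (s - 1)))"
    unfolding computable2_iff eq
    by (intro computable_list_if_le computable_list_comp2[OF cf] computable_list_arith) auto
  then show ?thesis using assms by (auto simp: computable_rat01_def)
qed

section \<open>Changes of direction\<close>

fun num_changes :: "(nat \<Rightarrow> 'a) \<Rightarrow> nat \<Rightarrow> nat" where
  "num_changes d 0 = 0"
| "num_changes d (Suc s) = num_changes d s + (if d (Suc s) = d s then 0 else 1)"

lemma num_changes_eq_card: "num_changes d s = card {t. t < s \<and> d (Suc t) \<noteq> d t}"
proof (induction s)
  case (Suc s)
  have "{t. t < Suc s \<and> d (Suc t) \<noteq> d t} =
      (if d (Suc s) = d s then {} else {s}) \<union> {t. t < s \<and> d (Suc t) \<noteq> d t}"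
    by (auto simp: less_Suc_eq)
  then show ?case using Suc by simp
qed simp

text \<open>Any finite set of changes lies before some stage, so it has at most \<open>k\<close>
  elements; an infinite set of changes would have a subset with \<open>Suc k\<close>
  elements.\<close>

lemma finite_changes:
  assumes "\<And>s. num_changes d s \<le> k"
  shows "finite {s. d (Suc s) \<noteq> d s}" and "card {s. d (Suc s) \<noteq> d s} \<le> k"
proof -
  have *: "finite T \<and> card T \<le> k" if "T \<subseteq> {s. d (Suc s) \<noteq> d s}" "finite T" for T
  proof -
    obtain m where "\<forall>t\<in>T. t < m" using \<open>finite T\<close> finite_nat_set_iff_bounded by auto
    then have "T \<subseteq> {t. t < m \<and> d (Suc t) \<noteq> d t}" using that(1) by auto
    then have "card T \<le> num_changes d m" unfolding num_changes_eq_card by (intro card_mono) auto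
    then show ?thesis using assms[of m] that(2) by simp
  qed
  show fin: "finite {s. d (Suc s) \<noteq> d s}"
  proof (rule ccontr)
    assume "infinite {s. d (Suc s) \<noteq> d s}"
    then obtain T where "T \<subseteq> {s. d (Suc s) \<noteq> d s}" "finite T" "card T = Suc k"
      using infinite_arbitrarily_large by blast
    then show False using *[of T] by simp
  qed
  show "card {s. d (Suc s) \<noteq> d s} \<le> k" using * fin by blast
qed

section \<open>Sequences with boundedly many turns\<close>

definition directed_by :: "(nat \<Rightarrow> bool) \<Rightarrow> (nat \<Rightarrow> 'a::linorder) \<Rightarrow> bool" where
  "directed_by d u \<longleftrightarrow> (\<forall>s. if d s then u s \<le> u (Suc s) else u (Suc s) \<le> u s)"

text \<open>The direction is chosen freely: it may start either way, and a constant step admits both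
  values. This makes the notion symmetric under order reversal with the same
  \<open>k\<close>.\<close>

definition piecewise_monotone :: "nat \<Rightarrow> (nat \<Rightarrow> 'a::linorder) \<Rightarrow> bool" where
  "piecewise_monotone k u \<longleftrightarrow> (\<exists>d. directed_by d u \<and> (\<forall>s. num_changes d s \<le> k))"

text \<open>At most \<open>k + l\<close> stages change one of the two directions, leaving at most
  \<open>k + l + 1\<close> stretches with both fixed. Each such stage and each stretch contributes
  at most one turn of the maximum, which gives \<open>2 * (k + l) + 1\<close>.\<close>

lemma piecewise_monotone_max:
  assumes "piecewise_monotone k u" "piecewise_monotone l v"
  shows "piecewise_monotone (2 * (k + l) + 1) (\<lambda>s. max (u s) (v s))"
proof -
  obtain d where d: "directed_by d u" "\<And>s. num_changes d s \<le> k"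
    using assms(1) by (auto simp: piecewise_monotone_def)
  obtain e where e: "directed_by e v" "\<And>s. num_changes e s \<le> l"
    using assms(2) by (auto simp: piecewise_monotone_def)
  \<comment> \<open>When \<open>u\<close> rises and \<open>v\<close> falls,
    \<open>v s \<le> u (Suc s)\<close> makes the maximum rise; otherwise both new values are at most
    \<open>v s\<close>. As \<open>u\<close> grows and \<open>v\<close> shrinks this condition
    persists once true. The opposite case is symmetric.\<close>
  define c where "c s = (if d s = e s then d s
    else if d s then v s \<le> u (Suc s) else u s \<le> v (Suc s))" for s
  have du: "if d s then u s \<le> u (Suc s) else u (Suc s) \<le> u s"
    and ev: "if e s then v s \<le> v (Suc s) else v (Suc s) \<le> v s" for s
    using d(1) e(1) by (auto simp: directed_by_def)
  have "directed_by c (\<lambda>s. max (u s) (v s))"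
    unfolding directed_by_def
  proof
    fix s
    show "if c s then max (u s) (v s) \<le> max (u (Suc s)) (v (Suc s))
      else max (u (Suc s)) (v (Suc s)) \<le> max (u s) (v s)"
      using du[of s] ev[of s] unfolding c_def
      by (cases "d s"; cases "e s") (auto simp: le_max_iff_disj not_le intro: order_trans less_imp_le)
  qed
  \<comment> \<open>The extra term for a falling maximum acts as a potential: a turn upwards is paid
    for by its disappearance, while a turn downwards raises the left side by 2, matched by a change
    of \<open>d\<close> or \<open>e\<close>.\<close>
  moreover have "num_changes c s + (if c s then 0 else 1) \<le> 2 * (num_changes d s + num_changes e s) + 1"
    for s
  proof (induction s)
    case (Suc s)
    show ?case
    proof (cases "d (Suc s) = d s \<and> e (Suc s) = e s")
      case True
      \<comment> \<open>While the directions of \<open>u\<close> and \<open>v\<close> stay fixed, the maximum can only turn upwards.\<close>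
      have "c s \<Longrightarrow> c (Suc s)"
        using du[of s] ev[of s] du[of "Suc s"] ev[of "Suc s"] True unfolding c_def
        by (cases "d s"; cases "e s") (auto intro: order_trans)
      then show ?thesis using Suc True by (auto split: if_splits)
    next
      case False
      then show ?thesis using Suc by (auto split: if_splits)
    qed
  qed simp
  then have "num_changes c s \<le> 2 * (k + l) + 1" for s
    using d(2)[of s] e(2)[of s] by (smt (verit) add_leE add_mono le_trans mult_le_mono2 add_le_mono1)
  ultimately show ?thesis by (auto simp: piecewise_monotone_def)
qed

lemma piecewise_monotone_compl:
  fixes u :: "nat \<Rightarrow> 'a::linordered_idom"
  assumes "piecewise_monotone k u"
  shows "piecewise_monotone k (\<lambda>s. 1 - u s)"
proof -
  obtain d where d: "directed_by d u" "\<And>s. num_changes d s \<le> k"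
    using assms(1) by (auto simp: piecewise_monotone_def)
  have "num_changes (\<lambda>s. \<not> d s) s = num_changes d s" for s by (induction s) auto
  moreover have "directed_by (\<lambda>s. \<not> d s) (\<lambda>s. 1 - u s)"
    using d(1) by (auto simp: directed_by_def)
  ultimately show ?thesis using d(2) unfolding piecewise_monotone_def
    by (intro exI[of _ "\<lambda>s. \<not> d s"]) simp
qed

text \<open>The new first step goes up because \<open>a \<le> u 0\<close>. The one possible
  additional change is between this step and the original first direction.\<close>

lemma piecewise_monotone_shift:
  assumes "piecewise_monotone k u" "a \<le> u 0"
  shows "piecewise_monotone (Suc k) (\<lambda>s. if s = 0 then a else u (s - 1))"
proof -
  obtain d where d: "directed_by d u" "\<And>s. num_changes d s \<le> k"
    using assms(1) by (auto simp: piecewise_monotone_def)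
  define e where "e s = (if s = 0 then True else d (s - 1))" for s
  have "directed_by e (\<lambda>s. if s = 0 then a else u (s - 1))"
    unfolding directed_by_def
  proof
    fix s
    show "if e s then (if s = 0 then a else u (s - 1)) \<le> (if Suc s = 0 then a else u (Suc s - 1))
       else (if Suc s = 0 then a else u (Suc s - 1)) \<le> (if s = 0 then a else u (s - 1))"
      using d(1) assms(2) by (cases s) (auto simp: directed_by_def e_def)
  qed
  moreover have "num_changes e (Suc s) \<le> Suc (num_changes d s)" for s
    by (induction s) (auto simp: e_def)
  then have "num_changes e s \<le> Suc k" for s
    using d(2) by (cases s) (auto intro: order_trans simp del: num_changes.simps(2))
  ultimately show ?thesis by (auto simp: piecewise_monotone_def)
qed

text \<open>\<open>mind_change\<close> turns only on a strict move against its current value, so it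
  then disagreed with \<open>d s\<close> and takes that direction at \<open>Suc s\<close>. Counting
  disagreement as a potential, each step raises the left side by at most the change of
  \<open>d\<close>. The final \<open>+ 1\<close> covers \<open>d 0\<close> being downward, since
  \<open>mind_change\<close> starts at 1.\<close>

lemma num_changes_mind_change_le:
  assumes "directed_by d (f x)"
  shows "num_changes (mind_change f x) s + (if (mind_change f x s = 1) = d s then 0 else 1)
    \<le> num_changes d s + 1"
proof (induction s)
  case (Suc s)
  have "if d s then f x s \<le> f x (Suc s) else f x (Suc s) \<le> f x s"
    using assms by (auto simp: directed_by_def)
  moreover have "mind_change f x s = 1 \<or> mind_change f x s = -1" by (cases s) auto
  ultimately show ?case using Suc by (auto split: if_splits)
qed simp

section \<open>Boolean combinations\<close>

text \<open>This invariant for the induction, with \<open>k\<close> uniform in \<open>x\<close>,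
  prescribes neither an initial value 0 nor an initial upward direction, since complement destroys
  both.\<close>

definition boundedly_approximable :: "fuzzy \<Rightarrow> bool" where
  "boundedly_approximable A \<longleftrightarrow> (\<exists>f k. computable_rat01 f \<and>
     (\<forall>x. (\<lambda>s. real_of_rat (f x s)) \<longlonglongrightarrow> A x \<and> piecewise_monotone k (f x)))"

lemma boundedly_approximable_ce:
  assumes "fuzzy_ce A"
  shows "boundedly_approximable A"
proof -
  obtain f where f: "computable_rat01 f" "\<And>x. (\<lambda>s. real_of_rat (f x s)) \<longlonglongrightarrow> A x"
    "\<And>x s. f x s \<le> f x (Suc s)"
    using assms by (auto simp: fuzzy_ce_def)
  have "num_changes (\<lambda>s. True) s = 0" for s by (induction s) auto
  then have "piecewise_monotone 0 (f x)" for x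
    unfolding piecewise_monotone_def directed_by_def using f(3)
    by (intro exI[of _ "\<lambda>s. True"]) simp
  then show ?thesis using f unfolding boundedly_approximable_def by blast
qed

lemma boundedly_approximable_union:
  assumes "boundedly_approximable A" "boundedly_approximable B"
  shows "boundedly_approximable (fuzzy_union A B)"
proof -
  obtain f k where f: "computable_rat01 f" "\<And>x. (\<lambda>s. real_of_rat (f x s)) \<longlonglongrightarrow> A x"
    "\<And>x. piecewise_monotone k (f x)"
    using assms(1) by (auto simp: boundedly_approximable_def)
  obtain g l where g: "computable_rat01 g" "\<And>x. (\<lambda>s. real_of_rat (g x s)) \<longlonglongrightarrow> B x"
    "\<And>x. piecewise_monotone l (g x)"
    using assms(2) by (auto simp: boundedly_approximable_def)
  have "real_of_rat (max p q) = max (real_of_rat p) (real_of_rat q)" for p q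
    by (simp add: max_def of_rat_less_eq)
  then have "(\<lambda>s. real_of_rat (max (f x s) (g x s))) \<longlonglongrightarrow> fuzzy_union A B x" for x
    using tendsto_max[OF f(2) g(2)] by (simp add: fuzzy_union_def)
  then show ?thesis
    using computable_rat01_max[OF f(1) g(1)] piecewise_monotone_max[OF f(3) g(3)]
    unfolding boundedly_approximable_def by blast
qed

lemma boundedly_approximable_compl:
  assumes "boundedly_approximable A"
  shows "boundedly_approximable (fuzzy_compl A)"
proof -
  obtain f k where f: "computable_rat01 f" "\<And>x. (\<lambda>s. real_of_rat (f x s)) \<longlonglongrightarrow> A x"
    "\<And>x. piecewise_monotone k (f x)"
    using assms(1) by (auto simp: boundedly_approximable_def)
  have "(\<lambda>s. real_of_rat (1 - f x s)) \<longlonglongrightarrow> fuzzy_compl A x" for x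
    using tendsto_diff[OF tendsto_const f(2)] by (simp add: fuzzy_compl_def of_rat_diff)
  then show ?thesis
    using computable_rat01_compl[OF f(1)] piecewise_monotone_compl[OF f(3)]
    unfolding boundedly_approximable_def by blast
qed

text \<open>De Morgan reduces intersection to the two operations treated directly.\<close>

lemma fuzzy_inter_conv_union:
  "fuzzy_inter A B = fuzzy_compl (fuzzy_union (fuzzy_compl A) (fuzzy_compl B))"
  by (auto simp: fuzzy_inter_def fuzzy_compl_def fuzzy_union_def fun_eq_iff)

lemma boundedly_approximable_boolean_combination:
  assumes "A \<in> boolean_combinations C" "\<forall>B\<in>C. fuzzy_ce B"
  shows "boundedly_approximable A"
  using assms(1)
proof induction
  case (base A)
  then show ?case using assms(2) boundedly_approximable_ce by blast
next
  case (inter A B)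
  then show ?case unfolding fuzzy_inter_conv_union
    by (intro boundedly_approximable_compl boundedly_approximable_union)
qed (auto intro: boundedly_approximable_union boundedly_approximable_compl)

lemma fuzzy_nce_of_boundedly_approximable:
  assumes "boundedly_approximable A"
  shows "\<exists>n\<ge>1. fuzzy_nce n A"
proof -
  obtain f k where f: "computable_rat01 f" "\<And>x. (\<lambda>s. real_of_rat (f x s)) \<longlonglongrightarrow> A x"
    "\<And>x. piecewise_monotone k (f x)"
    using assms(1) by (auto simp: boundedly_approximable_def)
  have f01: "0 \<le> f x s" "f x s \<le> 1" for x s using f(1) by (auto simp: computable_rat01_def)
  define g where "g x s = (if s = 0 then 0 else f x (s - 1))" for x s
  have "computable_rat01 g"
    using computable_rat01_shift[OF f(1)] by (simp add: g_def[abs_def])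
  moreover have "(\<lambda>s. real_of_rat (g x s)) \<longlonglongrightarrow> A x" for x
    using f(2)[of x] by (subst filterlim_sequentially_Suc[symmetric]) (simp add: g_def)
  \<comment> \<open>The shift costs one change, and passing from a free direction to
    \<open>mind_change\<close> costs another.\<close>
  moreover have "num_changes (mind_change g x) s \<le> k + 2" for x s
  proof -
    have "piecewise_monotone (Suc k) (g x)"
      using piecewise_monotone_shift[OF f(3) f01(1)] by (simp add: g_def[abs_def])
    then obtain d where d: "directed_by d (g x)" "num_changes d s \<le> Suc k"
      by (auto simp: piecewise_monotone_def)
    show ?thesis using num_changes_mind_change_le[where f = g and x = x, OF d(1), of s] d(2) by linarith
  qed
  note finite_changes[OF this]
  moreover have "g x 0 = 0" for x by (simp add: g_def)
  \<comment> \<open>The bounds on \<open>A\<close> are recovered from those on its approximations,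
    as weak inequalities pass to the limit.\<close>
  moreover have "fuzzy_set A"
    unfolding fuzzy_set_def
  proof
    fix x
    have "0 \<le> real_of_rat (f x s)" "real_of_rat (f x s) \<le> 1" for s
      using f01[of x s] by auto
    then show "A x \<in> {0..1}"
      using LIMSEQ_le_const[OF f(2)] LIMSEQ_le_const2[OF f(2)] by auto
  qed
  \<comment> \<open>Here \<open>n - 1\<close> must equal the bound \<open>k + 2\<close> on mind
    changes.\<close>
  ultimately have "fuzzy_nce (k + 3) A" unfolding fuzzy_nce_def by (intro conjI exI[of _ g]) auto
  then show ?thesis by (intro exI[of _ "k + 3"]) auto
qed

theorem corollary1:
  fixes C :: "fuzzy set" and A :: fuzzy
  assumes "finite C"
    and "\<forall>B\<in>C. fuzzy_ce B"
    and "A \<in> boolean_combinations C"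
  shows "\<exists>n\<ge>1. fuzzy_nce n A"
  using assms boundedly_approximable_boolean_combination fuzzy_nce_of_boundedly_approximable by blast

end
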